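(* Let $\mathcal{E}$ be the left hand side of any one of the deformed equations ${\rm H1}^\sigma_\epsilon$, ${\rm H2}^\sigma_\epsilon$, ${\rm H3}^\sigma_\epsilon$, with $\sigma=\pm1$. The deformed equation $$\mathcal{E}(u_{n,m},u_{n+1,m},u_{n,m+1},u_{n+1,m+1};n,m;\alpha,\beta;\sigma)=0$$ is the compatibility condition of the linear system $$\Psi_{n+1,m}=\mathcal{L}_{n,m}(u_{n,m},u_{n+1,m};\alpha,\lambda;\sigma)\,\Psi_{n,m},\qquad \Psi_{n,m+1}=\mathcal{L}_{n,m}(u_{n,m},u_{n,m+1};\beta,\lambda;\sigma)\,\Psi_{n,m},$$ where $$\mathcal{L}_{n,m}(x_1,x_2;\alpha,\lambda;\sigma):=\frac{1}{\sqrt{k(\alpha,\lambda)\,f(x_1,x_2;\alpha)}}\begin{pmatrix}\mathcal{E}_{,4}&-\mathcal{E}_{,34}\\ \mathcal{E}&-\mathcal{E}_{,3}\end{pmatrix}$$ and $\mathcal{E}=\mathcal{E}(x_1,x_2,x_3,x_4;n,m;\alpha,\lambda;\sigma)$ and its derivatives are evaluated at $x_3=x_4=0$.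
   Context: The unknown $u$ is a function $\mathbb{Z}\times\mathbb{Z}\to\mathbb{C}$, with $u_{n,m}=u(n,m)$; $\alpha,\beta$ are the lattice parameters, $\lambda$ is a further parameter, $\epsilon,\delta$ are constants, and $\sigma=\pm1$. Put $$\mathcal{X}_{n,m}=\frac{1+\sigma(-1)^{n+m}}{2},\qquad \mathcal{Y}_{n,m}=\frac{1-\sigma(-1)^{n+m}}{2}.$$ The polynomial $\mathcal{E}(x_1,x_2,x_3,x_4;n,m;\alpha,\beta;\sigma)$, affine linear in each $x_i$, is one of the following: - ${\rm H1}^\sigma_\epsilon$: $(x_1-x_4)(x_2-x_3)-(\alpha-\beta)+\epsilon(\alpha-\beta)\{\mathcal{X}_{n,m}x_2x_3+\mathcal{Y}_{n,m}x_1x_4\}$; - ${\rm H2}^\sigma_\epsilon$: $(x_1-x_4)(x_2-x_3)+(\beta-\alpha)(x_1+x_2+x_3+x_4)-\alpha^2+\beta^2-\epsilon(\beta-\alpha)^3-\epsilon(\beta-\alpha)\{2\mathcal{Y}_{n,m}x_1+2\mathcal{X}_{n,m}x_2+\alpha+\beta\}\{2\mathcal{Y}_{n,m}x_4+2\mathcal{X}_{n,m}x_3+\alpha+\beta\}$; - ${\rm H3}^\sigma_\epsilon$: $\alpha(x_1x_2+x_3x_4)-\beta(x_1x_3+x_2x_4)+(\alpha^2-\beta^2)\delta-\frac{\epsilon(\alpha^2-\beta^2)}{\alpha\beta}\{\mathcal{X}_{n,m}x_2x_3+\mathcal{Y}_{n,m}x_1x_4\}$. When the parameters displayed are $(\alpha,\lambda)$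 or $(\beta,\lambda)$, they replace $(\alpha,\beta)$ in these formulas. $\mathcal{E}_{,i}$ and $\mathcal{E}_{,ij}$ denote the first and second partial derivatives of $\mathcal{E}$ with respect to its $i$-th, respectively $i$-th and $j$-th, arguments. The functions $k$ and $f$ ($f$ depends also on $n,m,\sigma$ through $\mathcal{X}_{n,m},\mathcal{Y}_{n,m}$) are: - ${\rm H1}^\sigma_\epsilon$: $k(\alpha,\beta)=\beta-\alpha$, $f(u,x;\alpha)=1-\epsilon(\mathcal{Y}_{n,m}u^2+\mathcal{X}_{n,m}x^2)$; - ${\rm H2}^\sigma_\epsilon$: $k(\alpha,\beta)=\beta-\alpha$, $f(u,x;\alpha)=2\{u+x+\alpha-2\epsilon[\mathcal{Y}_{n,m}(u+\alpha)^2+\mathcal{X}_{n,m}(x+\alpha)^2]\}$; - ${\rm H3}^\sigma_\epsilon$: $k(\alpha,\beta)=\alpha^2-\beta^2$, $f(u,x;\alpha)=ux+\delta\alpha-\frac{\epsilon}{\alpha}(\mathcal{Y}_{n,m}u^2+\mathcal{X}_{n,m}x^2)$. Here $\Psi_{n,m}$ is a two-component vector (or $2\times 2$ matrix) function on the lattice, and the compatibility condition of the linear system is the condition that the two ways of computing $\Psi_{n+1,m+1}$ from $\Psi_{n,m}$ agree. *)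

theory Defs
  imports "HOL-Analysis.Analysis"
begin

text \<open>
  The constructor arguments are the constants of the equation: \<open>\<epsilon>\<close>, and for \<open>H3\<close> also \<open>\<delta>\<close>.
  The spectral parameter is written \<open>lam\<close>.
\<close>

datatype deformed_eq = H1 complex | H2 complex | H3 complex complex

definition parX :: "complex \<Rightarrow> int \<Rightarrow> int \<Rightarrow> complex" where
  "parX \<sigma> n m = (1 + \<sigma> * (- 1) powi (n + m)) / 2"

definition parY :: "complex \<Rightarrow> int \<Rightarrow> int \<Rightarrow> complex" where
  "parY \<sigma> n m = (1 - \<sigma> * (- 1) powi (n + m)) / 2"

fun quadE :: "deformed_eq \<Rightarrow> complex \<Rightarrow> int \<Rightarrow> int \<Rightarrow> complex \<Rightarrow> complex \<Rightarrow>
    complex \<Rightarrow> complex \<Rightarrow> complex \<Rightarrow> complex \<Rightarrow> complex" where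
  "quadE (H1 \<epsilon>) \<sigma> n m \<alpha> \<beta> x1 x2 x3 x4 =
     (x1 - x4) * (x2 - x3) - (\<alpha> - \<beta>)
     + \<epsilon> * (\<alpha> - \<beta>) * (parX \<sigma> n m * x2 * x3 + parY \<sigma> n m * x1 * x4)"
| "quadE (H2 \<epsilon>) \<sigma> n m \<alpha> \<beta> x1 x2 x3 x4 =
     (x1 - x4) * (x2 - x3) + (\<beta> - \<alpha>) * (x1 + x2 + x3 + x4) - \<alpha>^2 + \<beta>^2
     - \<epsilon> * (\<beta> - \<alpha>)^3
     - \<epsilon> * (\<beta> - \<alpha>) * (2 * parY \<sigma> n m * x1 + 2 * parX \<sigma> n m * x2 + \<alpha> + \<beta>)
         * (2 * parY \<sigma> n m * x4 + 2 * parX \<sigma> n m * x3 + \<alpha> + \<beta>)"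
| "quadE (H3 \<epsilon> \<delta>) \<sigma> n m \<alpha> \<beta> x1 x2 x3 x4 =
     \<alpha> * (x1 * x2 + x3 * x4) - \<beta> * (x1 * x3 + x2 * x4) + (\<alpha>^2 - \<beta>^2) * \<delta>
     - \<epsilon> * (\<alpha>^2 - \<beta>^2) / (\<alpha> * \<beta>) * (parX \<sigma> n m * x2 * x3 + parY \<sigma> n m * x1 * x4)"

fun kfun :: "deformed_eq \<Rightarrow> complex \<Rightarrow> complex \<Rightarrow> complex" where
  "kfun (H1 \<epsilon>) \<alpha> \<beta> = \<beta> - \<alpha>"
| "kfun (H2 \<epsilon>) \<alpha> \<beta> = \<beta> - \<alpha>"
| "kfun (H3 \<epsilon> \<delta>) \<alpha> \<beta> = \<alpha>^2 - \<beta>^2"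

fun ffun :: "deformed_eq \<Rightarrow> complex \<Rightarrow> int \<Rightarrow> int \<Rightarrow> complex \<Rightarrow> complex \<Rightarrow> complex \<Rightarrow> complex" where
  "ffun (H1 \<epsilon>) \<sigma> n m \<alpha> u x = 1 - \<epsilon> * (parY \<sigma> n m * u^2 + parX \<sigma> n m * x^2)"
| "ffun (H2 \<epsilon>) \<sigma> n m \<alpha> u x =
     2 * (u + x + \<alpha> - 2 * \<epsilon> * (parY \<sigma> n m * (u + \<alpha>)^2 + parX \<sigma> n m * (x + \<alpha>)^2))"
| "ffun (H3 \<epsilon> \<delta>) \<sigma> n m \<alpha> u x =
     u * x + \<delta> * \<alpha> - \<epsilon> / \<alpha> * (parY \<sigma> n m * u^2 + parX \<sigma> n m * x^2)"

text \<open>\<open>H3\<close> divides by its parameters.\<close>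

fun param_ok :: "deformed_eq \<Rightarrow> complex \<Rightarrow> bool" where
  "param_ok (H1 \<epsilon>) \<alpha> = True"
| "param_ok (H2 \<epsilon>) \<alpha> = True"
| "param_ok (H3 \<epsilon> \<delta>) \<alpha> = (\<alpha> \<noteq> 0)"

definition pd3 :: "(complex \<Rightarrow> complex \<Rightarrow> complex \<Rightarrow> complex \<Rightarrow> complex) \<Rightarrow>
    complex \<Rightarrow> complex \<Rightarrow> complex \<Rightarrow> complex \<Rightarrow> complex" where
  "pd3 F x1 x2 x3 x4 = deriv (\<lambda>t. F x1 x2 t x4) x3"

definition pd4 :: "(complex \<Rightarrow> complex \<Rightarrow> complex \<Rightarrow> complex \<Rightarrow> complex) \<Rightarrow>
    complex \<Rightarrow> complex \<Rightarrow> complex \<Rightarrow> complex \<Rightarrow> complex" where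
  "pd4 F x1 x2 x3 x4 = deriv (\<lambda>t. F x1 x2 x3 t) x4"

text \<open>
  The Lax matrix. The argument \<open>w\<close> is the value used for
  \<open>sqrt (k(\<alpha>,lam) f(x1,x2;\<alpha>))\<close>; see \<open>sqrt_choice\<close>.
\<close>

definition laxL :: "deformed_eq \<Rightarrow> complex \<Rightarrow> int \<Rightarrow> int \<Rightarrow> complex \<Rightarrow> complex \<Rightarrow> complex \<Rightarrow>
    complex \<Rightarrow> complex \<Rightarrow> complex^2^2" where
  "laxL eq \<sigma> n m \<alpha> lam w x1 x2 =
     (let F = quadE eq \<sigma> n m \<alpha> lam;
          M = (vector [vector [pd4 F x1 x2 0 0, - pd3 (pd4 F) x1 x2 0 0],
                       vector [F x1 x2 0 0, - pd3 F x1 x2 0 0]] :: complex^2^2)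
      in (\<chi> i j. 1 / w * M $ i $ j))"

text \<open>
  The square root is two-valued, and no single-valued branch of it, as a function of its argument
  \<open>k f\<close> or of \<open>x1, x2, \<alpha>, lam\<close> alone, makes the linear system compatible on solutions. For the
  constant solution \<open>u = v\<close>, \<open>2 v^2 = - (\<alpha> + \<beta>) \<delta>\<close> of \<open>H3 0 \<delta>\<close> the two unnormalised Lax matrices
  anticommute. The sign is therefore chosen edge by edge along a given \<open>u\<close>: \<open>r lam n m\<close> belongs
  to the edge from \<open>(n,m)\<close> to \<open>(n+1,m)\<close> and \<open>s lam n m\<close> to the edge from \<open>(n,m)\<close> to \<open>(n,m+1)\<close>.
\<close>

definition sqrt_choice :: "deformed_eq \<Rightarrow> complex \<Rightarrow> complex \<Rightarrow> complex \<Rightarrow> (int \<Rightarrow> int \<Rightarrow> complex) \<Rightarrow>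
    (complex \<Rightarrow> int \<Rightarrow> int \<Rightarrow> complex) \<Rightarrow> (complex \<Rightarrow> int \<Rightarrow> int \<Rightarrow> complex) \<Rightarrow> bool" where
  "sqrt_choice eq \<sigma> \<alpha> \<beta> u r s \<longleftrightarrow>
     (\<forall>lam n m. (r lam n m)^2 = kfun eq \<alpha> lam * ffun eq \<sigma> n m \<alpha> (u n m) (u (n+1) m) \<and>
                (s lam n m)^2 = kfun eq \<beta> lam * ffun eq \<sigma> n m \<beta> (u n m) (u n (m+1)))"

definition admissible :: "deformed_eq \<Rightarrow> complex \<Rightarrow> complex \<Rightarrow> complex \<Rightarrow> bool" where
  "admissible eq \<alpha> \<beta> lam \<longleftrightarrow> param_ok eq lam \<and> kfun eq \<alpha> lam \<noteq> 0 \<and> kfun eq \<beta> lam \<noteq> 0"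

text \<open>
  The two ways of computing \<open>\<Psi>(n+1,m+1)\<close> from \<open>\<psi> = \<Psi>(n,m)\<close> agree, for every value \<open>\<psi>\<close>.
\<close>

definition compatible_at :: "deformed_eq \<Rightarrow> complex \<Rightarrow> complex \<Rightarrow> complex \<Rightarrow> (int \<Rightarrow> int \<Rightarrow> complex) \<Rightarrow>
    (complex \<Rightarrow> int \<Rightarrow> int \<Rightarrow> complex) \<Rightarrow> (complex \<Rightarrow> int \<Rightarrow> int \<Rightarrow> complex) \<Rightarrow>
    complex \<Rightarrow> int \<Rightarrow> int \<Rightarrow> bool" where
  "compatible_at eq \<sigma> \<alpha> \<beta> u r s lam n m \<longleftrightarrow>
     (\<forall>\<psi> :: complex^2.
        laxL eq \<sigma> n (m+1) \<alpha> lam (r lam n (m+1)) (u n (m+1)) (u (n+1) (m+1)) *v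
          (laxL eq \<sigma> n m \<beta> lam (s lam n m) (u n m) (u n (m+1)) *v \<psi>)
        = laxL eq \<sigma> (n+1) m \<beta> lam (s lam (n+1) m) (u (n+1) m) (u (n+1) (m+1)) *v
          (laxL eq \<sigma> n m \<alpha> lam (r lam n m) (u n m) (u (n+1) m) *v \<psi>))"

end

theory Submission
  imports Defs
begin

text \<open>
  If \<open>\<E> = 0\<close>, the two unnormalised products of Lax matrices around a face become equal after
  multiplication by \<open>f(u,u\<^sub>1;\<alpha>)\<close> and \<open>f(u,u\<^sub>2;\<beta>)\<close> respectively. The normalised matrices have
  determinant 1, so the normalised products agree up to sign. Any prescribed sign on every face can
  be absorbed in the square roots: choose them freely on the vertical edges and propagate along
  \<open>m\<close> on the horizontal ones.

  Conversely, let \<open>lam\<close> tend to \<open>\<alpha>\<close>, where \<open>k(\<alpha>,lam)\<close> vanishes and the unnormalised Lax matrix of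
  the horizontal edges drops to rank one. The row vector \<open>(u\<^sub>2, 1)\<close> annihilates one of the two
  products there, hence also the other, and this says precisely that \<open>\<E> = 0\<close>.
\<close>

section \<open>Two-by-two matrices and the Lax matrix without its square root\<close>

definition mat2 :: "complex \<Rightarrow> complex \<Rightarrow> complex \<Rightarrow> complex \<Rightarrow> complex^2^2" where
  "mat2 a b c d = (vector [vector [a, b], vector [c, d]] :: complex^2^2)"

lemma mat2_nth [simp]:
  "mat2 a b c d $ 1 $ 1 = a" "mat2 a b c d $ 1 $ 2 = b"
  "mat2 a b c d $ 2 $ 1 = c" "mat2 a b c d $ 2 $ 2 = d"
  by (simp_all add: mat2_def)

lemma mat2_mult:
  "mat2 a b c d ** mat2 a' b' c' d' =
    mat2 (a * a' + b * c') (a * b' + b * d') (c * a' + d * c') (c * b' + d * d')"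
  by (auto simp: mat2_def vec_eq_iff forall_2 matrix_matrix_mult_def sum_2)

lemma det_mat2: "det (mat2 a b c d) = a * d - b * c"
  by (simp add: mat2_def det_2)

text \<open>Closed forms of the matrix of \<open>quadE\<close> and its derivatives at
  \<open>x3 = x4 = 0\<close>. Being free of \<open>deriv\<close>, they are accessible to polynomial
  arithmetic.\<close>

fun lax_num :: "deformed_eq \<Rightarrow> complex \<Rightarrow> int \<Rightarrow> int \<Rightarrow> complex \<Rightarrow> complex \<Rightarrow>
    complex \<Rightarrow> complex \<Rightarrow> complex^2^2" where
  "lax_num (H1 \<epsilon>) \<sigma> n m \<alpha> lam p q = mat2
     (\<epsilon> * (\<alpha> - lam) * (parY \<sigma> n m * p) - q) (- 1)
     (p * q - (\<alpha> - lam)) (p - \<epsilon> * (\<alpha> - lam) * (parX \<sigma> n m * q))"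
| "lax_num (H2 \<epsilon>) \<sigma> n m \<alpha> lam p q =
     (let d = lam - \<alpha>; s = \<alpha> + lam; t = 2 * parY \<sigma> n m * p + 2 * parX \<sigma> n m * q + s
      in mat2
        (d - q - 2 * \<epsilon> * d * parY \<sigma> n m * t) (- 1)
        (p * q + d * (p + q + s) - \<epsilon> * d ^ 3 - \<epsilon> * d * t * s)
        (p - d + 2 * \<epsilon> * d * parX \<sigma> n m * t))"
| "lax_num (H3 \<epsilon> \<delta>) \<sigma> n m \<alpha> lam p q =
     (let K = \<epsilon> * (\<alpha>^2 - lam^2) / (\<alpha> * lam)
      in mat2
        (- lam * q - K * (parY \<sigma> n m * p)) (- \<alpha>)
        (\<alpha> * (p * q) + (\<alpha>^2 - lam^2) * \<delta>) (lam * p + K * (parX \<sigma> n m * q)))"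

text \<open>Affine linearity in \<open>x3\<close> and \<open>x4\<close> makes the value and the
  derivatives at zero the coefficients of \<open>quadE\<close>. Projectively, the matrix sends a
  vector \<open>(1, - v)\<close> to a multiple of \<open>(1, - y)\<close>, where \<open>y\<close>
  solves \<open>quadE\<close> \<open>= 0\<close> with third argument \<open>v\<close>.\<close>

lemma lax_num_quadE:
  obtains a b c d where "lax_num eq \<sigma> n m \<alpha> lam p q = mat2 c (- d) a (- b)"
    "\<And>x y. quadE eq \<sigma> n m \<alpha> lam p q x y = a + b * x + c * y + d * x * y"
proof -
  have "\<exists>a b c d. lax_num eq \<sigma> n m \<alpha> lam p q = mat2 c (- d) a (- b) \<and>
    (\<forall>x y. quadE eq \<sigma> n m \<alpha> lam p q x y = a + b * x + c * y + d * x * y)"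
    (is "\<exists>a b c d. ?M = _ \<and> _")
  proof (intro exI conjI)
    \<comment> \<open>The coefficients are read off the matrix itself, so only the expansion of
      \<open>quadE\<close> remains to be checked case by case.\<close>
    show "?M = mat2 (?M $ 1 $ 1) (- (- ?M $ 1 $ 2)) (?M $ 2 $ 1) (- (- ?M $ 2 $ 2))"
      by (simp add: mat2_def vec_eq_iff forall_2)
  qed (cases eq; simp add: mat2_def Let_def algebra_simps power2_eq_square power3_eq_cube)
  with that show ?thesis by blast
qed

text \<open>The complex derivatives in \<open>laxL\<close> are evaluated here once; everything later
  passes through \<open>lax_num\<close>.\<close>

lemma laxL_eq: "laxL eq \<sigma> n m \<alpha> lam w p q = (\<chi> i j. lax_num eq \<sigma> n m \<alpha> lam p q $ i $ j / w)"
proof -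
  obtain a b c d where M: "lax_num eq \<sigma> n m \<alpha> lam p q = mat2 c (- d) a (- b)"
    and F: "\<And>x y. quadE eq \<sigma> n m \<alpha> lam p q x y = a + b * x + c * y + d * x * y"
    by (rule lax_num_quadE) blast
  have 4: "pd4 (quadE eq \<sigma> n m \<alpha> lam) p q x y = c + d * x" for x y
    unfolding pd4_def F by (rule DERIV_imp_deriv) (auto intro!: derivative_eq_intros)
  have 3: "pd3 (quadE eq \<sigma> n m \<alpha> lam) p q x y = b + d * y" for x y
    unfolding pd3_def F by (rule DERIV_imp_deriv) (auto intro!: derivative_eq_intros)
  have 34: "pd3 (pd4 (quadE eq \<sigma> n m \<alpha> lam)) p q x y = d" for x y
    unfolding pd3_def 4 by (rule DERIV_imp_deriv) (auto intro!: derivative_eq_intros)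
  show ?thesis
    unfolding laxL_def M Let_def 3 4 34 F mat2_def
    by (simp add: vec_eq_iff)
qed

section \<open>Parity, the determinant identity and the symmetry of a face\<close>

lemma par_cases:
  assumes "\<sigma> = 1 \<or> \<sigma> = - 1"
  obtains "parX \<sigma> n m = 1" "parY \<sigma> n m = 0" "parX \<sigma> (n+1) m = 0" "parY \<sigma> (n+1) m = 1"
    "parX \<sigma> n (m+1) = 0" "parY \<sigma> n (m+1) = 1"
  | "parX \<sigma> n m = 0" "parY \<sigma> n m = 1" "parX \<sigma> (n+1) m = 1" "parY \<sigma> (n+1) m = 0"
    "parX \<sigma> n (m+1) = 1" "parY \<sigma> n (m+1) = 0"
proof -
  have "((-1::complex) powi (n+m)) = 1 \<or> ((-1::complex) powi (n+m)) = -1"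
    by (simp add: power_int_minus_one_minus power_int_minus_left)
  moreover have "(-1::complex) powi (n+1+m) = - ((-1) powi (n+m))"
    "(-1::complex) powi (n+(m+1)) = - ((-1) powi (n+m))"
    by (simp_all add: power_int_add)
  ultimately show ?thesis
    using assms that unfolding parX_def parY_def by force
qed

text \<open>The determinant is \<open>a * d - b * c\<close> in the coefficients of
  \<open>quadE\<close>, that is, E times its mixed derivative minus the product of the two first
  derivatives. This biquadratic in \<open>p\<close>, \<open>q\<close> factors as \<open>k\<close>
  times \<open>f\<close>, which explains the normalisation of the Lax matrix.\<close>

lemma det_lax_num:
  assumes "\<sigma> = 1 \<or> \<sigma> = - 1" "param_ok eq \<alpha>" "param_ok eq lam"
  shows "det (lax_num eq \<sigma> n m \<alpha> lam p q) = kfun eq \<alpha> lam * ffun eq \<sigma> n m \<alpha> p q"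
proof (rule par_cases[OF assms(1), of n m]; cases eq)
qed (use assms(2,3) in \<open>simp_all add: Let_def det_mat2 field_simps power2_eq_square power3_eq_cube\<close>)

text \<open>A quarter turn of the face moves the base point to \<open>(n+1,m)\<close>: it exchanges
  the two lattice parameters and the two parities, and reverses the sign.\<close>

lemma quadE_swap:
  assumes "\<sigma> = 1 \<or> \<sigma> = - 1"
  shows "quadE eq \<sigma> (n+1) m \<beta> \<alpha> x1 y x x2 = - quadE eq \<sigma> n m \<alpha> \<beta> x x1 x2 y"
proof (rule par_cases[OF assms(1), of n m]; cases eq)
qed (simp_all add: algebra_simps diff_divide_distrib power2_eq_square power3_eq_cube)

section \<open>Unnormalised products around a face, on solutions\<close>

lemma lax_num_mult_H1:
  assumes "\<sigma> = 1 \<or> \<sigma> = - 1" and eq: "eq = H1 e"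
    and E: "quadE eq \<sigma> n m \<alpha> \<beta> x x1 x2 y = 0"
  shows "ffun eq \<sigma> n m \<alpha> x x1 * ((lax_num eq \<sigma> n (m+1) \<alpha> lam x2 y ** lax_num eq \<sigma> n m \<beta> lam x x2) $ i $ j)
    = ffun eq \<sigma> n m \<beta> x x2 * ((lax_num eq \<sigma> (n+1) m \<beta> lam x1 y ** lax_num eq \<sigma> n m \<alpha> lam x x1) $ i $ j)"
  (is "?l i j = ?r i j")
proof -
  \<comment> \<open>Once the parity is fixed, each of the four entries is a polynomial consequence
    of E \<open>= 0\<close>, left to Groebner bases.\<close>
  have "\<forall>i j. ?l i j = ?r i j"
  proof (rule par_cases[OF assms(1), of n m], goal_cases)
    case 1
    show ?case
      using E unfolding eq quadE.simps lax_num.simps ffun.simps Let_def mat2_mult mat2_nth forall_2 1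
      by (intro conjI; (algebra | simp))
  next
    case 2
    show ?case
      using E unfolding eq quadE.simps lax_num.simps ffun.simps Let_def mat2_mult mat2_nth forall_2 2
      by (intro conjI; (algebra | simp))
  qed
  then show ?thesis by blast
qed

lemma lax_num_mult_H2:
  assumes "\<sigma> = 1 \<or> \<sigma> = - 1" and eq: "eq = H2 e"
    and E: "quadE eq \<sigma> n m \<alpha> \<beta> x x1 x2 y = 0"
  shows "ffun eq \<sigma> n m \<alpha> x x1 * ((lax_num eq \<sigma> n (m+1) \<alpha> lam x2 y ** lax_num eq \<sigma> n m \<beta> lam x x2) $ i $ j)
    = ffun eq \<sigma> n m \<beta> x x2 * ((lax_num eq \<sigma> (n+1) m \<beta> lam x1 y ** lax_num eq \<sigma> n m \<alpha> lam x x1) $ i $ j)"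
  (is "?l i j = ?r i j")
proof -
  have "\<forall>i j. ?l i j = ?r i j"
  proof (rule par_cases[OF assms(1), of n m], goal_cases)
    case 1
    show ?case
      using E unfolding eq quadE.simps lax_num.simps ffun.simps Let_def mat2_mult mat2_nth forall_2 1
      by (intro conjI; (algebra | simp))
  next
    case 2
    show ?case
      using E unfolding eq quadE.simps lax_num.simps ffun.simps Let_def mat2_mult mat2_nth forall_2 2
      by (intro conjI; (algebra | simp))
  qed
  then show ?thesis by blast
qed

lemma lax_num_mult_H3:
  assumes "\<sigma> = 1 \<or> \<sigma> = - 1" and eq: "eq = H3 e \<delta>"
    and nz: "\<alpha> \<noteq> 0" "\<beta> \<noteq> 0" "lam \<noteq> 0"
    and E: "quadE eq \<sigma> n m \<alpha> \<beta> x x1 x2 y = 0"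
  shows "ffun eq \<sigma> n m \<alpha> x x1 * ((lax_num eq \<sigma> n (m+1) \<alpha> lam x2 y ** lax_num eq \<sigma> n m \<beta> lam x x2) $ i $ j)
    = ffun eq \<sigma> n m \<beta> x x2 * ((lax_num eq \<sigma> (n+1) m \<beta> lam x1 y ** lax_num eq \<sigma> n m \<alpha> lam x x1) $ i $ j)"
  (is "?l i j = ?r i j")
proof -
  \<comment> \<open>clears all denominators at once\<close>
  define \<eta> where "\<eta> = e / (\<alpha> * \<beta> * lam)"
  have K: "e * (\<alpha>^2 - \<beta>^2) / (\<alpha> * \<beta>) = \<eta> * lam * (\<alpha>^2 - \<beta>^2)"
    "e * (\<alpha>^2 - lam^2) / (\<alpha> * lam) = \<eta> * \<beta> * (\<alpha>^2 - lam^2)"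
    "e * (\<beta>^2 - lam^2) / (\<beta> * lam) = \<eta> * \<alpha> * (\<beta>^2 - lam^2)"
    "e / \<alpha> = \<eta> * \<beta> * lam" "e / \<beta> = \<eta> * \<alpha> * lam"
    unfolding \<eta>_def using nz by (simp_all add: field_simps)
  have "\<forall>i j. ?l i j = ?r i j"
  proof (rule par_cases[OF assms(1), of n m], goal_cases)
    case 1
    show ?case
      using E unfolding eq quadE.simps lax_num.simps ffun.simps Let_def mat2_mult mat2_nth forall_2 K 1
      by (intro conjI; (algebra | simp))
  next
    case 2
    show ?case
      using E unfolding eq quadE.simps lax_num.simps ffun.simps Let_def mat2_mult mat2_nth forall_2 K 2
      by (intro conjI; (algebra | simp))
  qed
  then show ?thesis by blast
qed

text \<open>Proportionality of the two products expresses consistency around the cube: both routes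
  give the same projective map. The explicit factors \<open>f\<close> make the ratio of the products
  computable.\<close>

lemma lax_num_mult:
  assumes "\<sigma> = 1 \<or> \<sigma> = - 1" and ok: "param_ok eq \<alpha>" "param_ok eq \<beta>" "param_ok eq lam"
    and E: "quadE eq \<sigma> n m \<alpha> \<beta> x x1 x2 y = 0"
  shows "ffun eq \<sigma> n m \<alpha> x x1 * ((lax_num eq \<sigma> n (m+1) \<alpha> lam x2 y ** lax_num eq \<sigma> n m \<beta> lam x x2) $ i $ j)
    = ffun eq \<sigma> n m \<beta> x x2 * ((lax_num eq \<sigma> (n+1) m \<beta> lam x1 y ** lax_num eq \<sigma> n m \<alpha> lam x x1) $ i $ j)"
  using assms lax_num_mult_H1 lax_num_mult_H2 lax_num_mult_H3
  by (cases eq) (auto simp del: quadE.simps ffun.simps lax_num.simps)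

section \<open>Normalised products and their sign ambiguity\<close>

lemma laxL_mult:
  "laxL eq \<sigma> n m \<alpha> lam w p q ** laxL eq \<sigma>' n' m' \<alpha>' lam' w' p' q' =
    (\<chi> i j. (lax_num eq \<sigma> n m \<alpha> lam p q ** lax_num eq \<sigma>' n' m' \<alpha>' lam' p' q') $ i $ j / (w * w'))"
  by (simp add: laxL_eq vec_eq_iff matrix_matrix_mult_def sum_2 add_divide_distrib)

lemma laxL_mult_uminus_left:
  "laxL eq \<sigma> n m \<alpha> lam (- w) p q ** laxL eq \<sigma>' n' m' \<alpha>' lam' w' p' q' =
    - (laxL eq \<sigma> n m \<alpha> lam w p q ** laxL eq \<sigma>' n' m' \<alpha>' lam' w' p' q')"
  by (simp add: laxL_mult vec_eq_iff)

lemma laxL_mult_uminus_right: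
  "laxL eq \<sigma> n m \<alpha> lam w p q ** laxL eq \<sigma>' n' m' \<alpha>' lam' (- w') p' q' =
    - (laxL eq \<sigma> n m \<alpha> lam w p q ** laxL eq \<sigma>' n' m' \<alpha>' lam' w' p' q')"
  by (simp add: laxL_mult vec_eq_iff)

lemma det_laxL:
  assumes "\<sigma> = 1 \<or> \<sigma> = - 1" "param_ok eq \<alpha>" "param_ok eq lam"
    and "w\<^sup>2 = kfun eq \<alpha> lam * ffun eq \<sigma> n m \<alpha> p q" "w \<noteq> 0"
  shows "det (laxL eq \<sigma> n m \<alpha> lam w p q) = 1"
proof -
  have "det (laxL eq \<sigma> n m \<alpha> lam w p q) = det (lax_num eq \<sigma> n m \<alpha> lam p q) / w\<^sup>2"
    by (simp add: laxL_eq det_2 power2_eq_square diff_divide_distrib)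
  also have "\<dots> = 1"
    using assms by (simp add: det_lax_num flip: assms(4))
  finally show ?thesis .
qed

lemma laxL_commute_up_to_sign:
  assumes sigma: "\<sigma> = 1 \<or> \<sigma> = - 1"
    and ok: "param_ok eq \<alpha>" "param_ok eq \<beta>" "param_ok eq lam"
    and w: "w1\<^sup>2 = kfun eq \<alpha> lam * ffun eq \<sigma> n (m+1) \<alpha> x2 y" "w1 \<noteq> 0"
      "w2\<^sup>2 = kfun eq \<beta> lam * ffun eq \<sigma> n m \<beta> x x2" "w2 \<noteq> 0"
      "v1\<^sup>2 = kfun eq \<beta> lam * ffun eq \<sigma> (n+1) m \<beta> x1 y" "v1 \<noteq> 0"
      "v2\<^sup>2 = kfun eq \<alpha> lam * ffun eq \<sigma> n m \<alpha> x x1" "v2 \<noteq> 0"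
    and E: "quadE eq \<sigma> n m \<alpha> \<beta> x x1 x2 y = 0"
  defines "P \<equiv> laxL eq \<sigma> n (m+1) \<alpha> lam w1 x2 y ** laxL eq \<sigma> n m \<beta> lam w2 x x2"
    and "Q \<equiv> laxL eq \<sigma> (n+1) m \<beta> lam v1 x1 y ** laxL eq \<sigma> n m \<alpha> lam v2 x x1"
  shows "P = Q \<or> P = - Q"
proof -
  \<comment> \<open>The ratio of \<open>P\<close> to \<open>Q\<close>: the two factors
    \<open>f\<close> come from \<open>lax_num_mult\<close>, the roots from the
    normalisation.\<close>
  define c where "c = ffun eq \<sigma> n m \<beta> x x2 * (v1 * v2) / (ffun eq \<sigma> n m \<alpha> x x1 * (w1 * w2))"
  have f: "ffun eq \<sigma> n m \<alpha> x x1 \<noteq> 0"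
    using w(7,8) by auto
  have PQ: "P $ i $ j = c * Q $ i $ j" for i j
    using lax_num_mult[OF sigma ok E, of i j] f w(2,4,6,8)
    unfolding P_def Q_def laxL_mult c_def by (simp add: field_simps)
  have "det P = 1" "det Q = 1"
    using w by (simp_all add: P_def Q_def det_mul det_laxL sigma ok)
  \<comment> \<open>The determinant is quadratic on two-by-two matrices, so comparing the two unit
    determinants forces \<open>c\<close> to be a sign.\<close>
  moreover have "det P = c\<^sup>2 * det Q"
    by (simp add: det_2 PQ power2_eq_square algebra_simps)
  ultimately have "c = 1 \<or> c = - 1"
    by (simp add: power2_eq_1_iff)
  then show ?thesis
    by (auto simp: vec_eq_iff PQ)
qed

section \<open>Compatibility as a matrix identity, and the choice of signs\<close>

lemma compatible_at_iff:
  "compatible_at eq \<sigma> \<alpha> \<beta> u r s lam n m \<longleftrightarrow>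
    laxL eq \<sigma> n (m+1) \<alpha> lam (r lam n (m+1)) (u n (m+1)) (u (n+1) (m+1)) **
      laxL eq \<sigma> n m \<beta> lam (s lam n m) (u n m) (u n (m+1))
    = laxL eq \<sigma> (n+1) m \<beta> lam (s lam (n+1) m) (u (n+1) m) (u (n+1) (m+1)) **
      laxL eq \<sigma> n m \<alpha> lam (r lam n m) (u n m) (u (n+1) m)"
  by (simp add: compatible_at_def matrix_eq matrix_vector_mul_assoc)

text \<open>Dependent choice along the integers, run separately upwards and downwards from
  0.\<close>

lemma int_chain_exists:
  assumes start: "\<exists>a. P 0 a"
    and up: "\<And>(m::int) a. P m a \<Longrightarrow> \<exists>b. P (m+1) b \<and> R m a b"
    and down: "\<And>m b. P (m+1) b \<Longrightarrow> \<exists>a. P m a \<and> R m a b"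
  shows "\<exists>f. \<forall>m. P m (f m) \<and> R m (f m) (f (m+1))"
proof -
  obtain a where a: "P 0 a"
    using start by blast
  \<comment> \<open>The clause for \<open>k = 0\<close> pins the upward chain to \<open>a\<close>.
    The downward chain has the same clause, so the two can be glued at 0.\<close>
  have "\<exists>g. \<forall>k. (P (int k) (g k) \<and> (k = 0 \<longrightarrow> g k = a)) \<and> R (int k) (g k) (g (Suc k))"
  proof (rule dependent_nat_choice)
    fix x k assume "P (int k) x \<and> (k = 0 \<longrightarrow> x = a)"
    with up[of "int k" x] show "\<exists>y. (P (int (Suc k)) y \<and> (Suc k = 0 \<longrightarrow> y = a)) \<and> R (int k) x y"
      by (auto simp: add.commute)
  qed (use a in auto)
  then obtain g where g: "P (int k) (g k)" "g 0 = a" "R (int k) (g k) (g (Suc k))" for k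
    by blast
  have "\<exists>h. \<forall>k. (P (- int k) (h k) \<and> (k = 0 \<longrightarrow> h k = a)) \<and> R (- int (Suc k)) (h (Suc k)) (h k)"
  proof (rule dependent_nat_choice)
    fix x k assume "P (- int k) x \<and> (k = 0 \<longrightarrow> x = a)"
    with down[of "- int (Suc k)" x]
    show "\<exists>y. (P (- int (Suc k)) y \<and> (Suc k = 0 \<longrightarrow> y = a)) \<and> R (- int (Suc k)) y x"
      by auto
  qed (use a in auto)
  then obtain h where h: "P (- int k) (h k)" "h 0 = a" "R (- int (Suc k)) (h (Suc k)) (h k)" for k
    by blast
  define f where "f m = (if m \<ge> 0 then g (nat m) else h (nat (- m)))" for m :: int
  have "P m (f m) \<and> R m (f m) (f (m+1))" for m
  proof (cases "m \<ge> 0")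
    case True
    then show ?thesis
      using g(1,3)[of "nat m"] by (auto simp: f_def nat_add_distrib)
  next
    case False
    define k where "k = nat (- m - 1)"
    have m: "m = - int (Suc k)"
      using False by (simp add: k_def)
    have "f m = h (Suc k)" "f (m+1) = h k"
      using g(2) h(2) by (cases k; auto simp: f_def m nat_add_distrib)+
    then show ?thesis
      using h(1)[of "Suc k"] h(3)[of k] by (simp add: m algebra_simps)
  qed
  then show ?thesis by blast
qed

text \<open>On solutions one of the two signs gives equality. Off solutions a sign that fails is
  wanted, and one exists because \<open>Q\<close> is invertible and so cannot equal both
  \<open>P\<close> and \<open>- P\<close>.\<close>

lemma face_sign_choice:
  assumes sigma: "\<sigma> = 1 \<or> \<sigma> = - 1"
    and ok: "param_ok eq \<alpha>" "param_ok eq \<beta>" "param_ok eq lam"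
    and w: "w1\<^sup>2 = kfun eq \<alpha> lam * ffun eq \<sigma> n (m+1) \<alpha> x2 y" "w1 \<noteq> 0"
      "w2\<^sup>2 = kfun eq \<beta> lam * ffun eq \<sigma> n m \<beta> x x2" "w2 \<noteq> 0"
      "v1\<^sup>2 = kfun eq \<beta> lam * ffun eq \<sigma> (n+1) m \<beta> x1 y" "v1 \<noteq> 0"
      "v2\<^sup>2 = kfun eq \<alpha> lam * ffun eq \<sigma> n m \<alpha> x x1" "v2 \<noteq> 0"
  defines "P \<equiv> laxL eq \<sigma> n (m+1) \<alpha> lam w1 x2 y ** laxL eq \<sigma> n m \<beta> lam w2 x x2"
    and "Q \<equiv> laxL eq \<sigma> (n+1) m \<beta> lam v1 x1 y ** laxL eq \<sigma> n m \<alpha> lam v2 x x1"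
    and "E \<equiv> quadE eq \<sigma> n m \<alpha> \<beta> x x1 x2 y"
  shows "(E = 0 \<longleftrightarrow> P = Q) \<or> (E = 0 \<longleftrightarrow> P = - Q)"
proof -
  have "\<not> (P = Q \<and> P = - Q)"
  proof
    assume "P = Q \<and> P = - Q"
    then have "Q $ i $ j = - (Q $ i $ j)" for i j
      by (metis vector_uminus_component)
    then have "Q $ i $ j = 0" for i j
      by (simp add: eq_neg_iff_add_eq_0)
    moreover have "det Q = 1"
      using w by (simp add: Q_def det_mul det_laxL sigma ok)
    ultimately show False by (simp add: det_2)
  qed
  then show ?thesis
    using laxL_commute_up_to_sign[OF sigma ok w] unfolding P_def Q_def E_def by blast
qed

section \<open>The limit of the spectral parameter at \<alpha>\<close>

lemma isCont_lax_num:
  assumes "param_ok eq \<alpha>" "param_ok eq c"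
  shows "isCont (\<lambda>lam. lax_num eq \<sigma> n m \<alpha> lam p q $ i $ j) c"
proof -
  have "\<forall>i j. isCont (\<lambda>lam. lax_num eq \<sigma> n m \<alpha> lam p q $ i $ j) c"
    using assms by (cases eq) (auto simp: forall_2 Let_def intro!: continuous_intros)
  then show ?thesis by blast
qed

text \<open>At \<open>lam\<close> = \<alpha> the matrix is \<kappa> times the column
  \<open>(1, - p)\<close> times the row \<open>(- q, - 1)\<close>, in agreement with the vanishing
  of its determinant.\<close>

lemma lax_num_diag:
  assumes "param_ok eq \<alpha>"
  obtains \<kappa> where "\<kappa> \<noteq> 0"
    "lax_num eq \<sigma> n m \<alpha> \<alpha> p q = mat2 (- \<kappa> * q) (- \<kappa>) (\<kappa> * (p * q)) (\<kappa> * p)"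
proof (cases eq)
  case (H3 \<epsilon> \<delta>)
  with that[of \<alpha>] assms show ?thesis by simp
qed (use that[of 1] in simp_all)

text \<open>Only finitely many values of \<open>lam\<close> are excluded. One of them is \<alpha>
  itself, so the limit is taken over a punctured neighbourhood.\<close>

lemma eventually_admissible:
  assumes "param_ok eq \<alpha>"
  shows "\<forall>\<^sub>F lam in at \<alpha>. admissible eq \<alpha> \<beta> lam"
proof -
  have ne: "\<forall>\<^sub>F lam in at \<alpha>. lam \<noteq> c" for c
    by (rule eventually_neq_at_within)
  have "\<forall>\<^sub>F lam in at \<alpha>. lam \<noteq> 0 \<and> lam \<noteq> \<alpha> \<and> lam \<noteq> - \<alpha> \<and> lam \<noteq> \<beta> \<and> lam \<noteq> - \<beta>"
    by (intro eventually_conj ne)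
  then show ?thesis
    by eventually_elim (cases eq; auto simp: admissible_def power2_eq_iff)
qed

lemma quadE_eq_0_if_compatible:
  assumes sigma: "\<sigma> = 1 \<or> \<sigma> = - 1"
    and ok: "param_ok eq \<alpha>" "param_ok eq \<beta>"
    and f_nonzero: "\<And>n m. ffun eq \<sigma> n m \<alpha> (u n m) (u (n+1) m) \<noteq> 0"
      "\<And>n m. ffun eq \<sigma> n m \<beta> (u n m) (u n (m+1)) \<noteq> 0"
    and sq: "sqrt_choice eq \<sigma> \<alpha> \<beta> u r s"
    and compat: "\<And>lam. admissible eq \<alpha> \<beta> lam \<Longrightarrow> compatible_at eq \<sigma> \<alpha> \<beta> u r s lam n m"
  shows "quadE eq \<sigma> n m \<alpha> \<beta> (u n m) (u (n+1) m) (u n (m+1)) (u (n+1) (m+1)) = 0"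
proof -
  define x x1 x2 y where xy: "x = u n m" "x1 = u (n+1) m" "x2 = u n (m+1)" "y = u (n+1) (m+1)"
  define P where "P lam = lax_num eq \<sigma> n (m+1) \<alpha> lam x2 y ** lax_num eq \<sigma> n m \<beta> lam x x2" for lam
  define Q where "Q lam = lax_num eq \<sigma> (n+1) m \<beta> lam x1 y ** lax_num eq \<sigma> n m \<alpha> lam x x1" for lam
  \<comment> \<open>The second entry of the row \<open>(x2, 1)\<close> times
    \<open>M\<close>.\<close>
  define \<phi> where "\<phi> M = M $ 2 $ 2 + x2 * M $ 1 $ 2" for M :: "complex^2^2"
  define a where "a = ffun eq \<sigma> n m \<alpha> x x1 * ffun eq \<sigma> (n+1) m \<beta> x1 y"
  define b where "b = ffun eq \<sigma> n (m+1) \<alpha> x2 y * ffun eq \<sigma> n m \<beta> x x2"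
  have "b \<noteq> 0"
    using f_nonzero by (simp add: b_def xy)
  \<comment> \<open>Squaring removes the roots, whose signs may jump with \<open>lam\<close>. The
    common factor \<open>k(\<alpha>,lam) k(\<beta>,lam)\<close> is cancelled while it is nonzero,
    since it vanishes in the limit.\<close>
  have eq0: "(\<phi> (P lam))\<^sup>2 * a - (\<phi> (Q lam))\<^sup>2 * b = 0" if adm: "admissible eq \<alpha> \<beta> lam" for lam
  proof -
    define w v where wv: "w = r lam n (m+1) * s lam n m" "v = s lam (n+1) m * r lam n m"
    define k where "k = kfun eq \<alpha> lam * kfun eq \<beta> lam"
    have k: "k \<noteq> 0" using adm by (simp add: k_def admissible_def)
    have w2: "w\<^sup>2 = k * b" and v2: "v\<^sup>2 = k * a"
      using sq unfolding sqrt_choice_def wv a_def b_def k_def xy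
      by (simp_all add: power_mult_distrib)
    have "a \<noteq> 0" using f_nonzero by (simp add: a_def xy)
    then have nz: "w \<noteq> 0" "v \<noteq> 0" using w2 v2 k \<open>b \<noteq> 0\<close> by auto
    have "P lam $ i $ j / w = Q lam $ i $ j / v" for i j
      using compat[OF adm] unfolding compatible_at_iff laxL_mult P_def Q_def wv xy
      by (simp add: vec_eq_iff)
    then have "\<phi> (P lam) / w = \<phi> (Q lam) / v"
      by (simp add: \<phi>_def add_divide_distrib flip: times_divide_eq_right)
    then have "\<phi> (P lam) * v = \<phi> (Q lam) * w"
      using nz by (simp add: field_simps)
    then have "(\<phi> (P lam) * v)\<^sup>2 = (\<phi> (Q lam) * w)\<^sup>2" by simp
    then have "k * ((\<phi> (P lam))\<^sup>2 * a) = k * ((\<phi> (Q lam))\<^sup>2 * b)"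
      by (simp only: power_mult_distrib w2 v2 mult_ac)
    then show ?thesis using k by simp
  qed
  have "isCont (\<lambda>lam. (\<phi> (P lam))\<^sup>2 * a - (\<phi> (Q lam))\<^sup>2 * b) \<alpha>"
    unfolding \<phi>_def P_def Q_def matrix_matrix_mult_def
    by (simp add: sum_2,
        intro isCont_lax_num continuous_diff continuous_add continuous_mult continuous_power
          continuous_const ok)
  moreover have "((\<lambda>lam. (\<phi> (P lam))\<^sup>2 * a - (\<phi> (Q lam))\<^sup>2 * b) \<longlongrightarrow> 0) (at \<alpha>)"
    by (rule tendsto_eventually, rule eventually_mono[OF eventually_admissible[OF ok(1)] eq0])
  ultimately have lim: "(\<phi> (P \<alpha>))\<^sup>2 * a - (\<phi> (Q \<alpha>))\<^sup>2 * b = 0"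
    using isContD LIM_unique by blast
  \<comment> \<open>The left factor of \<open>P\<close> has column \<open>(1, - x2)\<close>, which
    the row \<open>(x2, 1)\<close> annihilates.\<close>
  have "\<phi> (P \<alpha>) = 0"
  proof -
    obtain \<kappa> where 1: "lax_num eq \<sigma> n (m+1) \<alpha> \<alpha> x2 y = mat2 (- \<kappa> * y) (- \<kappa>) (\<kappa> * (x2 * y)) (\<kappa> * x2)"
      using lax_num_diag[OF ok(1)] by blast
    show ?thesis
      unfolding \<phi>_def P_def 1 by (simp add: matrix_matrix_mult_def sum_2 algebra_simps)
  qed
  with lim \<open>b \<noteq> 0\<close> have \<phi>Q: "\<phi> (Q \<alpha>) = 0" by simp
  obtain \<kappa> where \<kappa>: "\<kappa> \<noteq> 0"
      and 1: "lax_num eq \<sigma> n m \<alpha> \<alpha> x x1 = mat2 (- \<kappa> * x1) (- \<kappa>) (\<kappa> * (x * x1)) (\<kappa> * x)"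
    using lax_num_diag[OF ok(1)] by blast
  obtain a b c d where 2: "lax_num eq \<sigma> (n+1) m \<beta> \<alpha> x1 y = mat2 c (- d) a (- b)"
    and F: "\<And>s t. quadE eq \<sigma> (n+1) m \<beta> \<alpha> x1 y s t = a + b * s + c * t + d * s * t"
    by (rule lax_num_quadE) blast
  \<comment> \<open>The second column of the right factor inserts \<open>x\<close> as third argument
    of \<open>quadE\<close>, and the row \<open>(x2, 1)\<close> inserts \<open>x2\<close> as
    fourth.\<close>
  have "\<phi> (Q \<alpha>) = - \<kappa> * quadE eq \<sigma> (n+1) m \<beta> \<alpha> x1 y x x2"
    unfolding \<phi>_def Q_def 1 2 F by (simp add: mat2_mult algebra_simps)
  then show ?thesis
    using \<phi>Q \<kappa> quadE_swap[OF sigma] by (simp add: xy)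
qed

text \<open>A wrong sign of a root spoils compatibility even on solutions, so the equivalence is
  claimed for suitable roots. The second conjunct recovers the equation from compatibility for all
  admissible \<open>lam\<close>, whatever the roots.\<close>

theorem proposition4p3:
  fixes eq :: deformed_eq and \<sigma> \<alpha> \<beta> :: complex and u :: "int \<Rightarrow> int \<Rightarrow> complex"
  assumes sigma: "\<sigma> = 1 \<or> \<sigma> = - 1"
    and params: "param_ok eq \<alpha>" "param_ok eq \<beta>"
    and f_nonzero: "\<And>n m. ffun eq \<sigma> n m \<alpha> (u n m) (u (n+1) m) \<noteq> 0"
      "\<And>n m. ffun eq \<sigma> n m \<beta> (u n m) (u n (m+1)) \<noteq> 0"
  shows "(\<exists>r s. sqrt_choice eq \<sigma> \<alpha> \<beta> u r s \<and>
           (\<forall>lam n m. admissible eq \<alpha> \<beta> lam \<longrightarrow>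
              (quadE eq \<sigma> n m \<alpha> \<beta> (u n m) (u (n+1) m) (u n (m+1)) (u (n+1) (m+1)) = 0
               \<longleftrightarrow> compatible_at eq \<sigma> \<alpha> \<beta> u r s lam n m)))
       \<and> (\<forall>r s n m. sqrt_choice eq \<sigma> \<alpha> \<beta> u r s \<longrightarrow>
            (\<forall>lam. admissible eq \<alpha> \<beta> lam \<longrightarrow> compatible_at eq \<sigma> \<alpha> \<beta> u r s lam n m) \<longrightarrow>
            quadE eq \<sigma> n m \<alpha> \<beta> (u n m) (u (n+1) m) (u n (m+1)) (u (n+1) (m+1)) = 0)"
proof (intro conjI allI impI)
  \<comment> \<open>The vertical roots are fixed arbitrarily; only the horizontal ones will be
    adjusted.\<close>
  define s where "s lam n m = csqrt (kfun eq \<beta> lam * ffun eq \<sigma> n m \<beta> (u n m) (u n (m+1)))" for lam n m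
  define C where "C lam n m a b \<longleftrightarrow>
      laxL eq \<sigma> n (m+1) \<alpha> lam b (u n (m+1)) (u (n+1) (m+1)) **
        laxL eq \<sigma> n m \<beta> lam (s lam n m) (u n m) (u n (m+1))
      = laxL eq \<sigma> (n+1) m \<beta> lam (s lam (n+1) m) (u (n+1) m) (u (n+1) (m+1)) **
        laxL eq \<sigma> n m \<alpha> lam a (u n m) (u (n+1) m)" for lam n m a b
  define E where "E n m = quadE eq \<sigma> n m \<alpha> \<beta> (u n m) (u (n+1) m) (u n (m+1)) (u (n+1) (m+1))" for n m
  define P where "P lam n m a \<longleftrightarrow> a\<^sup>2 = kfun eq \<alpha> lam * ffun eq \<sigma> n m \<alpha> (u n m) (u (n+1) m)" for lam n m a
  define R where "R lam n m a b \<longleftrightarrow> (admissible eq \<alpha> \<beta> lam \<longrightarrow> (E n m = 0 \<longleftrightarrow> C lam n m a b))" for lam n m a b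
  have neg: "C lam n m (- a) b \<longleftrightarrow> C lam n m a (- b)" for lam n m a b
    unfolding C_def laxL_mult_uminus_left laxL_mult_uminus_right by (metis minus_minus)
  \<comment> \<open>Negating the root \<open>b\<close> on the upper edge turns \<open>P\<close> of
    \<open>face_sign_choice\<close> into \<open>- P\<close>. For inadmissible \<open>lam\<close>
    nothing is required.\<close>
  have sgn: "R lam n m a b \<or> R lam n m a (- b)" if "P lam n m a" "P lam n (m+1) b" for lam n m a b
  proof (cases "admissible eq \<alpha> \<beta> lam")
    case True
    then have lam: "param_ok eq lam" "kfun eq \<alpha> lam \<noteq> 0" "kfun eq \<beta> lam \<noteq> 0"
      by (auto simp: admissible_def)
    with that f_nonzero have "a \<noteq> 0" "b \<noteq> 0"
      by (auto simp: P_def)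
    with lam that f_nonzero face_sign_choice[OF sigma params lam(1), where ?w1.0 = b and ?v2.0 = a and n = n and m = m]
    show ?thesis
      unfolding R_def C_def E_def P_def s_def laxL_mult_uminus_left
      by (metis (no_types) csqrt_eq_0 minus_equation_iff mult_eq_0_iff power2_csqrt)
  qed (simp add: R_def)
  \<comment> \<open>With \<open>s\<close> fixed, a face constrains only its lower and upper edges,
    so each vertical strip of faces is treated separately, for each \<open>lam\<close>.\<close>
  have "\<exists>f. \<forall>m. P lam n m (f m) \<and> R lam n m (f m) (f (m+1))" for lam n
  proof (rule int_chain_exists)
    show "\<exists>a. P lam n 0 a"
      unfolding P_def using power2_csqrt by blast
    have ex: "\<exists>b. P lam n m b" for m
      unfolding P_def using power2_csqrt by blast
    have uminus: "P lam n m (- a)" if "P lam n m a" for m a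
      using that by (simp add: P_def)
    show "\<exists>b. P lam n (m+1) b \<and> R lam n m a b" if "P lam n m a" for m a
      using ex[of "m+1"] sgn[OF that] uminus by blast
    \<comment> \<open>Going down, \<open>b\<close> is already fixed, so \<open>neg\<close> moves the
      sign from \<open>b\<close> to \<open>a\<close>.\<close>
    show "\<exists>a. P lam n m a \<and> R lam n m a b" if "P lam n (m+1) b" for m b
      using ex[of m] sgn[OF _ that] uminus neg unfolding R_def by blast
  qed
  then obtain r where r: "P lam n m (r lam n m)" "R lam n m (r lam n m) (r lam n (m+1))" for lam n m
    by metis
  have "sqrt_choice eq \<sigma> \<alpha> \<beta> u r s"
    using r(1) by (simp add: sqrt_choice_def P_def s_def)
  moreover have "E n m = 0 \<longleftrightarrow> compatible_at eq \<sigma> \<alpha> \<beta> u r s lam n m"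
    if "admissible eq \<alpha> \<beta> lam" for lam n m
    using r(2) that by (simp add: R_def C_def compatible_at_iff)
  ultimately show "\<exists>r s. sqrt_choice eq \<sigma> \<alpha> \<beta> u r s \<and>
           (\<forall>lam n m. admissible eq \<alpha> \<beta> lam \<longrightarrow>
              (quadE eq \<sigma> n m \<alpha> \<beta> (u n m) (u (n+1) m) (u n (m+1)) (u (n+1) (m+1)) = 0
               \<longleftrightarrow> compatible_at eq \<sigma> \<alpha> \<beta> u r s lam n m))"
    unfolding E_def by blast
qed (use quadE_eq_0_if_compatible[OF sigma params f_nonzero] in blast)

end
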